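(* Let $C^{ijkl}$ be an elasticity tensor in three dimensions, and let $S^{ijkl}:=C^{(ijkl)}$, $A^{ijkl}:=C^{ijkl}-S^{ijkl}$ and $M^{ijkl}:=C^{i(jk)l}$. Then $$M^{ijkl}=S^{ijkl}+A^{i(jk)l} .$$
   Context: Indices run over $1,2,3$. An elasticity tensor is a real fourth-rank tensor $C^{ijkl}$ on $\mathbb R^3$ with $C^{ijkl}=C^{jikl}$, $C^{ijkl}=C^{ijlk}$ (minor symmetries) and $C^{ijkl}=C^{klij}$ (major symmetry). Parentheses around $p$ indices denote total symmetrization over them ($\frac1{p!}$ times the sum over all permutations), so $A^{i(jk)l}=\frac12(A^{ijkl}+A^{ikjl})$. *)

theory Defs
  imports Complex_Main "HOL-Library.Numeral_Type" "HOL-Combinatorics.Permutations"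
begin

text \<open>Components of a real fourth-rank tensor on \<open>\<real>\<^sup>3\<close>. The index range is the three-element
  type \<open>3\<close>, whose elements are \<open>1\<close>, \<open>2\<close> and \<open>3 = 0\<close>.\<close>

type_synonym tensor4 = "3 \<Rightarrow> 3 \<Rightarrow> 3 \<Rightarrow> 3 \<Rightarrow> real"

definition elasticity_tensor :: "tensor4 \<Rightarrow> bool" where
  "elasticity_tensor C \<longleftrightarrow>
     (\<forall>i j k l. C i j k l = C j i k l) \<and>
     (\<forall>i j k l. C i j k l = C i j l k) \<and>
     (\<forall>i j k l. C i j k l = C k l i j)"

text \<open>The parenthesis notation. \<open>P\<close> is the set of index slots inside the parentheses, the four
  slots being numbered 0 to 3 from left to right: \<open>T\<^bsup>(ijkl)\<^esup>\<close> is \<open>symmetrize {0, 1, 2, 3} T i j k l\<close>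
  and \<open>T\<^bsup>i(jk)l\<^esup>\<close> is \<open>symmetrize {1, 2} T i j k l\<close>. Only \<open>P \<subseteq> {0, 1, 2, 3}\<close> is meaningful.\<close>

definition symmetrize :: "nat set \<Rightarrow> tensor4 \<Rightarrow> tensor4" where
  "symmetrize P T i j k l =
     (1 / fact (card P)) *
     (\<Sum>p | p permutes P.
        T ([i, j, k, l] ! p 0) ([i, j, k, l] ! p 1) ([i, j, k, l] ! p 2) ([i, j, k, l] ! p 3))"

lemma symmetrize_middle:
  "symmetrize {1, 2} T i j k l = (T i j k l + T i k j l) / 2"
proof -
  have perms: "{p. p permutes {1, 2 :: nat}} = {id, transpose 1 2}"
    by (auto simp: permutes_doubleton_iff)
  have "transpose 1 2 (1 :: nat) \<noteq> id 1"
    by simp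
  then have "id \<noteq> transpose 1 (2 :: nat)"
    by metis
  then show ?thesis
    unfolding symmetrize_def perms by (simp add: transpose_def numeral_2_eq_2 numeral_3_eq_3)
qed

end

theory Submission
  imports Defs
begin

text \<open>Symmetrization over the middle slots is linear and C = S + A, so it suffices that it
  fixes S. It does, because S is totally symmetric and hence unchanged by exchanging j and k;
  \<open>symmetrize_swap_middle\<close> supplies this.\<close>

lemma symmetrize_swap_middle:
  assumes "{1, 2} \<subseteq> P" and "P \<subseteq> {0, 1, 2, 3}"
  shows "symmetrize P T i k j l = symmetrize P T i j k l"
proof -
  let ?t = "transpose 1 (2 :: nat)"
  have nth_swap: "[i, k, j, l] ! n = [i, j, k, l] ! ?t n" if "n \<in> {0, 1, 2, 3}" for n
    using that by (elim insertE emptyE) (simp_all add: transpose_def)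
  \<comment> \<open>A permutation of \<open>P\<close> also permutes all four slots, so
    \<open>nth_swap\<close> applies at each \<open>p n\<close>.\<close>
  have in_slots: "p n \<in> {0, 1, 2, 3}" if "p permutes P" "n \<in> {0, 1, 2, 3}" for p n
    using that(2) unfolding permutes_in_image[OF permutes_subset[OF that(1) assms(2)]] .
  have "?t permutes P"
    using assms(1) by (intro permutes_swap_id) auto
  \<comment> \<open>Reindex by the bijection p \<mapsto> \<open>?t \<circ> p\<close>; the extra
    \<open>?t\<close> is then absorbed by exchanging j and k in the index list.\<close>
  then have "symmetrize P T i j k l =
      (1 / fact (card P)) * (\<Sum>p | p permutes P.
        T ([i, j, k, l] ! ?t (p 0)) ([i, j, k, l] ! ?t (p 1))
          ([i, j, k, l] ! ?t (p 2)) ([i, j, k, l] ! ?t (p 3)))"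
    unfolding symmetrize_def by (subst setum_permutations_compose_left) (simp_all only: o_apply)
  also have "\<dots> = symmetrize P T i k j l"
    unfolding symmetrize_def
    by (intro arg_cong2[where f = "(*)"] sum.cong refl)
      (simp only: mem_Collect_eq nth_swap[OF in_slots] insert_iff simp_thms)
  finally show ?thesis ..
qed

theorem proposition11:
  fixes C S A M :: tensor4
  assumes "elasticity_tensor C"
    and "\<And>i j k l. S i j k l = symmetrize {0, 1, 2, 3} C i j k l"
    and "\<And>i j k l. A i j k l = C i j k l - S i j k l"
    and "\<And>i j k l. M i j k l = symmetrize {1, 2} C i j k l"
  shows "M i j k l = S i j k l + symmetrize {1, 2} A i j k l"
proof -
  have "S i k j l = S i j k l"
    unfolding assms(2) by (rule symmetrize_swap_middle) auto
  then show ?thesis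
    \<comment> \<open>Both sides become averages of two terms. \<open>One_nat_def\<close> would turn
      \<open>{1, 2}\<close> into a form that \<open>symmetrize_middle\<close> does not
      match.\<close>
    by (simp add: assms(3,4) symmetrize_middle field_simps del: One_nat_def)
qed

end
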